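(* Let $n\ge 1$, let $A,B,X$ be complex $n\times n$ matrices such that the $2n\times 2n$ block matrix $\begin{bmatrix} A & X\\ X^* & B\end{bmatrix}$ is positive, and let $d=\mathrm{dist}(0,W(X))$. Then, for every symmetric norm $\|\cdot\|$ on $\mathbb{M}_{2n}$, $$ \left\| \begin{bmatrix} A & X\\ X^* & B\end{bmatrix}\right\| \ \ge\ \left\| \left(\frac{A+B}{2}+dI\right)\oplus\left(\frac{A+B}{2}-dI\right)\right\| . $$
   Context: $\mathbb{M}_n$ is the space of complex $n\times n$ matrices. "Positive" means Hermitian positive semidefinite. $I$ is the identity matrix, and $S\oplus T$ denotes the block-diagonal matrix $\begin{bmatrix} S&0\\0&T\end{bmatrix}$. The numerical range of $X\in\mathbb{M}_n$ is $W(X)=\{\langle h,Xh\rangle : h\in\mathbb{C}^n,\ \|h\|=1\}$, with $\langle\cdot,\cdot\rangle$ the canonical inner product of $\mathbb{C}^n$ and $\|h\|$ the Euclidean norm; it is a compact convex subset of $\mathbb{C}$. $\mathrm{dist}(0,W(X))=\min\{|z| : z\in W(X)\}$. A symmetric norm (also called unitarily invariant norm) on $\mathbb{M}_{2n}$ is a norm satisfying $\|UTV\|=\|T\|$ for all $T\in\mathbb{M}_{2n}$ and all unitary $U,V\in\mathbb{M}_{2n}$. *)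

theory Defs
  imports
    "HOL-Analysis.Elementary_Metric_Spaces"
    "HOL-Analysis.L2_Norm"
    "Jordan_Normal_Form.Schur_Decomposition"
begin

(* The scalar product v \<bullet>c w of the library is linear in v and conjugate-linear in w, so the
   canonical inner product <h, X h> of the text (linear in the second argument) is
   (X *\<^sub>v h) \<bullet>c h; mat_adjoint is the conjugate transpose. *)

definition positive_mat :: "nat \<Rightarrow> complex mat \<Rightarrow> bool" where
  "positive_mat m M \<longleftrightarrow>
     M \<in> carrier_mat m m \<and> mat_adjoint M = M \<and>
     (\<forall>v \<in> carrier_vec m. 0 \<le> Re ((M *\<^sub>v v) \<bullet>c v))"

definition unitary_mat :: "nat \<Rightarrow> complex mat \<Rightarrow> bool" where
  "unitary_mat m U \<longleftrightarrow>
     U \<in> carrier_mat m m \<and> mat_adjoint U * U = 1\<^sub>m m \<and> U * mat_adjoint U = 1\<^sub>m m"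

definition euclidean_norm :: "complex vec \<Rightarrow> real" where
  "euclidean_norm h = L2_set (\<lambda>i. cmod (h $ i)) {..<dim_vec h}"

definition numerical_range :: "nat \<Rightarrow> complex mat \<Rightarrow> complex set" where
  "numerical_range n X =
     {(X *\<^sub>v h) \<bullet>c h | h. h \<in> carrier_vec n \<and> euclidean_norm h = 1}"

(* Only the values of N on m-by-m matrices matter. *)
definition matrix_norm :: "nat \<Rightarrow> (complex mat \<Rightarrow> real) \<Rightarrow> bool" where
  "matrix_norm m N \<longleftrightarrow>
     (\<forall>S \<in> carrier_mat m m. 0 \<le> N S) \<and>
     (\<forall>S \<in> carrier_mat m m. N S = 0 \<longleftrightarrow> S = 0\<^sub>m m m) \<and>
     (\<forall>c. \<forall>S \<in> carrier_mat m m. N (c \<cdot>\<^sub>m S) = cmod c * N S) \<and>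
     (\<forall>S \<in> carrier_mat m m. \<forall>T \<in> carrier_mat m m. N (S + T) \<le> N S + N T)"

definition symmetric_norm :: "nat \<Rightarrow> (complex mat \<Rightarrow> real) \<Rightarrow> bool" where
  "symmetric_norm m N \<longleftrightarrow>
     matrix_norm m N \<and>
     (\<forall>T \<in> carrier_mat m m. \<forall>U V. unitary_mat m U \<longrightarrow> unitary_mat m V \<longrightarrow> N (U * T * V) = N T)"

definition direct_sum_mat :: "complex mat \<Rightarrow> complex mat \<Rightarrow> complex mat" where
  "direct_sum_mat S T =
     four_block_mat S (0\<^sub>m (dim_row S) (dim_col T)) (0\<^sub>m (dim_row T) (dim_col S)) T"

end

theory Submission
  imports Defs
begin

text \<open>
  Why the inequality holds. Write \<open>M\<close> for the block matrix and \<open>S = (A + B) / 2\<close>. A symmetric norm does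
  not grow when a matrix is replaced by its diagonal part (\<open>norm_diagonal_le\<close>), and it does not see a
  unitary change of basis. Hence it is enough to find one orthonormal basis of
  \<open>\<complex>\<^sup>2\<^sup>n\<close> in which the diagonal of \<open>M\<close> consists of the eigenvalues
  \<open>s\<^sub>i + d\<close> and \<open>s\<^sub>i - d\<close> of the direct sum on the other side, where the \<open>s\<^sub>i\<close> are the
  eigenvalues of \<open>S\<close>.

  Let \<open>v\<^sub>i\<close> be an orthonormal eigenbasis of \<open>S\<close> (\<open>hermitian_diagonalization\<close>). The compression of
  \<open>M\<close> to the plane spanned by \<open>(v\<^sub>i, 0)\<close> and \<open>(0, v\<^sub>i)\<close> is a Hermitian 2-by-2 matrix with trace
  \<open>2 s\<^sub>i\<close>, and its off-diagonal entry \<open>x\<^sub>i\<close> is the value of the quadratic form of \<open>X\<close> at the unit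
  vector \<open>v\<^sub>i\<close>. So \<open>x\<^sub>i\<close> lies in the numerical range and has modulus at least \<open>d\<close>, and some
  \<open>u\<^sub>i\<close> on the unit circle makes the real part of \<open>u\<^sub>i x\<^sub>i\<close> equal to \<open>d\<close>
  (\<open>phase_with_real_part\<close>). On the orthonormal basis \<open>(v\<^sub>i, u\<^sub>i v\<^sub>i) / sqrt 2\<close> and
  \<open>(v\<^sub>i, - u\<^sub>i v\<^sub>i) / sqrt 2\<close> of that plane, the quadratic form of \<open>M\<close> takes exactly the values
  \<open>s\<^sub>i + d\<close> and \<open>s\<^sub>i - d\<close> (\<open>phase_mat_conjugation\<close>). These planes together give the basis.
\<close>

section \<open>Adjoints and unitary conjugation\<close>

lemma index_mat_adjoint [simp]:
  fixes A :: "complex mat"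
  assumes "i < dim_col A" "j < dim_row A"
  shows "mat_adjoint A $$ (i, j) = cnj (A $$ (j, i))"
  using assms unfolding mat_adjoint_def by (simp add: mat_of_rows_def)

lemma dim_mat_adjoint [simp]:
  fixes A :: "complex mat"
  shows "dim_row (mat_adjoint A) = dim_col A" "dim_col (mat_adjoint A) = dim_row A"
  unfolding mat_adjoint_def by (simp_all add: mat_of_rows_def)

lemma mat_adjoint_carrier [simp]:
  fixes A :: "complex mat"
  shows "A \<in> carrier_mat m n \<Longrightarrow> mat_adjoint A \<in> carrier_mat n m"
  by (rule carrier_matI) (simp_all add: carrier_matD)

lemma mat_adjoint_adjoint [simp]:
  fixes A :: "complex mat"
  shows "mat_adjoint (mat_adjoint A) = A"
  by (rule eq_matI) auto

lemma mat_adjoint_mult: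
  fixes A B :: "complex mat"
  assumes "A \<in> carrier_mat l m" "B \<in> carrier_mat m n"
  shows "mat_adjoint (A * B) = mat_adjoint B * mat_adjoint A"
  using assms by (intro eq_matI) (auto simp: scalar_prod_def mult.commute)

lemma mat_adjoint_four_block:
  fixes A B C D :: "complex mat"
  assumes "A \<in> carrier_mat m n" "B \<in> carrier_mat m n'" "C \<in> carrier_mat m' n" "D \<in> carrier_mat m' n'"
  shows "mat_adjoint (four_block_mat A B C D) =
    four_block_mat (mat_adjoint A) (mat_adjoint C) (mat_adjoint B) (mat_adjoint D)"
  using assms by (intro eq_matI) auto

text \<open>
  This is the bridge between matrix algebra and quadratic forms: for unitary \<open>U\<close>, the
  diagonal entries of the conjugate are values of the form at unit vectors, and for \<open>M\<close> the identity
  the entries are the inner products of the columns.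
\<close>

lemma index_conjugation:
  fixes M U :: "complex mat"
  assumes M: "M \<in> carrier_mat n n" and U: "U \<in> carrier_mat n n" and ij: "i < n" "j < n"
  shows "(mat_adjoint U * M * U) $$ (i, j) = (M *\<^sub>v col U j) \<bullet>c col U i"
proof -
  have row: "row (mat_adjoint U) i = conjugate (col U i)"
    using U ij by (intro eq_vecI) auto
  have "mat_adjoint U * M * U = mat_adjoint U * (M * U)"
    using assoc_mult_mat[OF mat_adjoint_carrier[OF U] M U] .
  also have "\<dots> $$ (i, j) = row (mat_adjoint U) i \<bullet> col (M * U) j"
    using U M ij by simp
  also have "\<dots> = conjugate (col U i) \<bullet> (M *\<^sub>v col U j)"
    using U M ij row by (simp add: mult_mat_vec_def)
  also have "\<dots> = (M *\<^sub>v col U j) \<bullet>c col U i"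
    using U M ij by (intro comm_scalar_prod[of _ n]) auto
  finally show ?thesis .
qed

lemma unitary_matI:
  assumes "U \<in> carrier_mat n n" "mat_adjoint U * U = 1\<^sub>m n"
  shows "unitary_mat n U"
  unfolding unitary_mat_def
  using assms mat_mult_left_right_inverse[OF mat_adjoint_carrier[OF assms(1)] assms] by blast

lemma unitary_mat_carrier: "unitary_mat n U \<Longrightarrow> U \<in> carrier_mat n n"
  by (simp add: unitary_mat_def)

lemma unitary_mat_adjoint: "unitary_mat n U \<Longrightarrow> unitary_mat n (mat_adjoint U)"
  by (simp add: unitary_mat_def)

lemma conjugation_mult:
  fixes U V M :: "complex mat"
  assumes U: "U \<in> carrier_mat n n" and V: "V \<in> carrier_mat n n" and M: "M \<in> carrier_mat n n"
  shows "mat_adjoint (U * V) * M * (U * V) = mat_adjoint V * (mat_adjoint U * M * U) * V"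
proof -
  have "mat_adjoint U \<in> carrier_mat n n" "mat_adjoint V \<in> carrier_mat n n" using U V by auto
  with U V M show ?thesis
    by (simp add: mat_adjoint_mult[OF U V] assoc_mult_mat[of _ n n _ n _ n]
      mult_carrier_mat[of _ n n _ n])
qed

lemma unitary_mat_mult:
  assumes U: "unitary_mat n U" and V: "unitary_mat n V"
  shows "unitary_mat n (U * V)"
proof (rule unitary_matI)
  have c: "U \<in> carrier_mat n n" "V \<in> carrier_mat n n"
    using U V by (simp_all add: unitary_mat_def)
  then show UV: "U * V \<in> carrier_mat n n" by simp
  \<comment> \<open>Unitarity says that conjugation fixes the identity, so \<open>conjugation_mult\<close> settles the product.\<close>
  have "mat_adjoint (U * V) * (U * V) = mat_adjoint (U * V) * 1\<^sub>m n * (U * V)"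
    using UV by (metis mat_adjoint_carrier right_mult_one_mat)
  also have "\<dots> = mat_adjoint V * (mat_adjoint U * 1\<^sub>m n * U) * V"
    using conjugation_mult[OF c, of "1\<^sub>m n"] by simp
  also have "\<dots> = 1\<^sub>m n"
    using U V c by (simp add: unitary_mat_def right_mult_one_mat[OF mat_adjoint_carrier])
  finally show "mat_adjoint (U * V) * (U * V) = 1\<^sub>m n" .
qed

section \<open>Direct sums\<close>

lemma direct_sum_mat_carrier:
  assumes "S \<in> carrier_mat m m" "T \<in> carrier_mat n n"
  shows "direct_sum_mat S T \<in> carrier_mat (m + n) (m + n)"
  using assms by (simp add: direct_sum_mat_def)

lemma direct_sum_mat_eq:
  assumes "S \<in> carrier_mat m m" "T \<in> carrier_mat n n"
  shows "direct_sum_mat S T = four_block_mat S (0\<^sub>m m n) (0\<^sub>m n m) T"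
  using assms by (simp add: direct_sum_mat_def)

lemma conjugation_direct_sum:
  assumes "U \<in> carrier_mat m m" "V \<in> carrier_mat n n"
    and "A \<in> carrier_mat m m" "X \<in> carrier_mat m n" "Y \<in> carrier_mat n m" "B \<in> carrier_mat n n"
  shows "mat_adjoint (direct_sum_mat U V) * four_block_mat A X Y B * direct_sum_mat U V =
    four_block_mat (mat_adjoint U * A * U) (mat_adjoint U * X * V)
      (mat_adjoint V * Y * U) (mat_adjoint V * B * V)"
proof -
  have z: "mat_adjoint (0\<^sub>m a b :: complex mat) = 0\<^sub>m b a" for a b by (rule eq_matI) auto
  have adj: "mat_adjoint (direct_sum_mat U V) =
      four_block_mat (mat_adjoint U) (0\<^sub>m m n) (0\<^sub>m n m) (mat_adjoint V)"
    using mat_adjoint_four_block[OF assms(1) zero_carrier_mat zero_carrier_mat assms(2)]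
    by (simp add: direct_sum_mat_eq[OF assms(1,2)] z)
  have U': "mat_adjoint U \<in> carrier_mat m m" and V': "mat_adjoint V \<in> carrier_mat n n"
    using assms by auto
  have c: "mat_adjoint U * A \<in> carrier_mat m m" "mat_adjoint U * X \<in> carrier_mat m n"
      "mat_adjoint V * Y \<in> carrier_mat n m" "mat_adjoint V * B \<in> carrier_mat n n"
    using assms U' V' by auto
  have "mat_adjoint (direct_sum_mat U V) * four_block_mat A X Y B =
      four_block_mat (mat_adjoint U * A) (mat_adjoint U * X) (mat_adjoint V * Y) (mat_adjoint V * B)"
    unfolding adj using assms c
    by (subst mult_four_block_mat[OF U' zero_carrier_mat zero_carrier_mat V' assms(3-6)])
       (simp add: left_add_zero_mat[OF c(3)] left_add_zero_mat[OF c(4)]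
         right_add_zero_mat[OF c(1)] right_add_zero_mat[OF c(2)])
  moreover have "mat_adjoint U * A * U \<in> carrier_mat m m" "mat_adjoint U * X * V \<in> carrier_mat m n"
      "mat_adjoint V * Y * U \<in> carrier_mat n m" "mat_adjoint V * B * V \<in> carrier_mat n n"
    using c assms by auto
  ultimately show ?thesis unfolding direct_sum_mat_eq[OF assms(1,2)]
    by (simp add: mult_four_block_mat[OF c assms(1) zero_carrier_mat zero_carrier_mat assms(2)]
         right_mult_zero_mat[OF c(1)] right_mult_zero_mat[OF c(2)]
         right_mult_zero_mat[OF c(3)] right_mult_zero_mat[OF c(4)]
         left_add_zero_mat right_add_zero_mat)
qed

lemma unitary_direct_sum:
  assumes U: "unitary_mat m U" and V: "unitary_mat n V"
  shows "unitary_mat (m + n) (direct_sum_mat U V)"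
proof (rule unitary_matI)
  note c = unitary_mat_carrier[OF U] unitary_mat_carrier[OF V]
  show W: "direct_sum_mat U V \<in> carrier_mat (m + n) (m + n)"
    using direct_sum_mat_carrier c .
  have W': "mat_adjoint (direct_sum_mat U V) \<in> carrier_mat (m + n) (m + n)"
    using mat_adjoint_carrier[OF W] .
  have "mat_adjoint (direct_sum_mat U V) * direct_sum_mat U V =
      mat_adjoint (direct_sum_mat U V) * four_block_mat (1\<^sub>m m) (0\<^sub>m m n) (0\<^sub>m n m) (1\<^sub>m n) * direct_sum_mat U V"
    by (simp add: right_mult_one_mat[OF W'])
  also have "\<dots> = 1\<^sub>m (m + n)"
    using U V c mat_adjoint_carrier[OF c(1)] mat_adjoint_carrier[OF c(2)]
    by (subst conjugation_direct_sum) (auto simp: unitary_mat_def right_mult_zero_mat left_mult_zero_mat)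
  finally show "mat_adjoint (direct_sum_mat U V) * direct_sum_mat U V = 1\<^sub>m (m + n)" .
qed

section \<open>Unitary diagonalization of Hermitian matrices\<close>

text \<open>
  Completing \<open>v\<close> to a basis and orthogonalizing keeps the first vector, and normalizing the columns
  only rescales it.
\<close>

lemma unitary_with_first_column:
  fixes v :: "complex vec"
  assumes v: "v \<in> carrier_vec n" and v0: "v \<noteq> 0\<^sub>v n" and n: "0 < n"
  obtains U c where "unitary_mat n U" "col U 0 = c \<cdot>\<^sub>v v"
proof -
  interpret cof_vec_space n "TYPE(complex)" .
  define b where "b = basis_completion v"
  define ws where "ws = gram_schmidt n b"
  note bc = basis_completion[OF v v0, folded b_def]
  note gs = gram_schmidt_result[OF bc(2) bc(4) bc(5) ws_def]
  have len: "length ws = n" using gs bc by simp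
  obtain vs where "b = v # vs" using bc(6,7) n by (cases b) auto
  then have "hd ws = v" using gram_schmidt_hd[OF v] ws_def by simp
  then have ws0: "ws ! 0 = v" using len n hd_conv_nth[of ws] by auto
  have ws: "ws ! j \<in> carrier_vec n" if "j < n" for j using gs(3) len that by auto
  define c where "c j = complex_of_real (1 / sqrt (Re (ws ! j \<bullet>c ws ! j)))" for j
  define U where "U = mat_of_cols n (map (\<lambda>j. c j \<cdot>\<^sub>v ws ! j) [0..<n])"
  have U: "U \<in> carrier_mat n n" unfolding U_def by auto
  have colU: "col U j = c j \<cdot>\<^sub>v ws ! j" if "j < n" for j
    using that ws unfolding U_def by (subst col_mat_of_cols) auto
  have "mat_adjoint U * U = 1\<^sub>m n"
  proof (rule eq_matI)
    fix i j assume "i < dim_row (1\<^sub>m n :: complex mat)" "j < dim_col (1\<^sub>m n :: complex mat)"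
    then have ij: "i < n" "j < n" by auto
    have "(mat_adjoint U * U) $$ (i, j) = (mat_adjoint U * 1\<^sub>m n * U) $$ (i, j)"
      using U by (simp add: right_mult_one_mat[OF mat_adjoint_carrier])
    also have "\<dots> = (1\<^sub>m n *\<^sub>v col U j) \<bullet>c col U i"
      using index_conjugation[OF one_carrier_mat U ij] .
    also have "\<dots> = c j * cnj (c i) * (ws ! j \<bullet>c ws ! i)"
      using ij ws[OF ij(1)] ws[OF ij(2)] 
      by (simp add: colU conjugate_smult_vec one_mult_mat_vec[of _ n])
    also have "\<dots> = 1\<^sub>m n $$ (i, j)"
    proof (cases "i = j")
      case False
      then have "ws ! j \<bullet>c ws ! i = 0" using corthogonalD[OF gs(2), of j i] ij len by auto
      then show ?thesis using False ij by simp
    next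
      case True
      have ne: "ws ! j \<bullet>c ws ! j \<noteq> 0" using corthogonalD[OF gs(2), of j j] ij len by auto
      have ge: "ws ! j \<bullet>c ws ! j \<ge> 0" by (rule conjugate_square_ge_0_vec)
      define r where "r = Re (ws ! j \<bullet>c ws ! j)"
      have eq: "ws ! j \<bullet>c ws ! j = complex_of_real r" and r: "r > 0"
        using ne ge unfolding r_def by (auto simp: less_eq_complex_def complex_eq_iff)
      have "c j * cnj (c j) = complex_of_real (1 / r)"
        unfolding c_def r_def[symmetric] using r by (simp flip: of_real_mult)
      then show ?thesis using True ij eq r by simp
    qed
    finally show "(mat_adjoint U * U) $$ (i, j) = 1\<^sub>m n $$ (i, j)" .
  qed (use U in auto)
  then have "unitary_mat n U" by (rule unitary_matI[OF U])
  moreover have "col U 0 = c 0 \<cdot>\<^sub>v v" using colU[OF n] ws0 by simp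
  ultimately show ?thesis by (rule that)
qed

lemma mat_has_eigenvector:
  fixes A :: "complex mat"
  assumes A: "A \<in> carrier_mat n n" and n: "0 < n"
  obtains v e where "v \<in> carrier_vec n" "v \<noteq> 0\<^sub>v n" "A *\<^sub>v v = e \<cdot>\<^sub>v v"
proof -
  have "degree (char_poly A) = n" using degree_monic_char_poly[OF A] by simp
  then have "\<not> constant (poly (char_poly A))"
    using n by (simp add: constant_degree)
  then obtain e where "poly (char_poly A) e = 0"
    using fundamental_theorem_of_algebra by blast
  then have "eigenvalue A e" using eigenvalue_root_char_poly[OF A] by simp
  then show ?thesis using that A unfolding eigenvalue_def eigenvector_def by auto
qed

lemma conjugation_hermitian:
  fixes U M :: "complex mat"
  assumes "U \<in> carrier_mat n n" "M \<in> carrier_mat n n" "mat_adjoint M = M"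
  shows "mat_adjoint (mat_adjoint U * M * U) = mat_adjoint U * M * U"
proof -
  have U': "mat_adjoint U \<in> carrier_mat n n" using assms by simp
  have "mat_adjoint (mat_adjoint U * M * U) = mat_adjoint U * (M * U)"
    using mat_adjoint_mult[OF mult_carrier_mat[OF U' assms(2)] assms(1)]
    by (simp add: mat_adjoint_mult[OF U' assms(2)] assms(3))
  then show ?thesis using assoc_mult_mat[OF U' assms(2,1)] by simp
qed

text \<open>
  Induction on the size. In an orthonormal basis that starts with an eigenvector, the first column of
  the matrix vanishes below the diagonal; by Hermitian symmetry so does the rest of the first row, and
  the matrix splits into a 1-by-1 block and a smaller Hermitian block.
\<close>

lemma hermitian_diagonalization:
  fixes S :: "complex mat"
  assumes "S \<in> carrier_mat n n" "mat_adjoint S = S"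
  shows "\<exists>V s. unitary_mat n V \<and> mat_adjoint V * S * V = mat_diag n s"
  using assms
proof (induction n arbitrary: S)
  case 0
  have "mat_adjoint (1\<^sub>m 0) * (1\<^sub>m 0 :: complex mat) = 1\<^sub>m 0" by (rule eq_matI) auto
  then have "unitary_mat 0 (1\<^sub>m 0)" by (intro unitary_matI) auto
  moreover have "mat_adjoint (1\<^sub>m 0) * S * (1\<^sub>m 0) = mat_diag 0 s" for s
    using 0 by (intro eq_matI) (auto simp: mat_diag_def)
  ultimately show ?case by blast
next
  case (Suc k)
  let ?n = "Suc k"
  obtain v e where v: "v \<in> carrier_vec ?n" "v \<noteq> 0\<^sub>v ?n" and ev: "S *\<^sub>v v = e \<cdot>\<^sub>v v"
    using mat_has_eigenvector[OF Suc.prems(1)] by blast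
  obtain U c where U: "unitary_mat ?n U" and col0: "col U 0 = c \<cdot>\<^sub>v v"
    using unitary_with_first_column[OF v] by blast
  note cU = unitary_mat_carrier[OF U]
  define T where "T = mat_adjoint U * S * U"
  have cT: "T \<in> carrier_mat ?n ?n" using cU Suc.prems unfolding T_def by auto
  have hT: "mat_adjoint T = T"
    unfolding T_def using conjugation_hermitian[OF cU Suc.prems] .
  have T0: "T $$ (i, 0) = (if i = 0 then e else 0)" if i: "i < ?n" for i
  proof -
    have c0: "col U 0 \<in> carrier_vec ?n" and ci: "col U i \<in> carrier_vec ?n"
      using col_dim[of U] cU unfolding carrier_matD(1)[OF cU] by blast+
    have "T $$ (i, 0) = (S *\<^sub>v col U 0) \<bullet>c col U i"
      unfolding T_def using index_conjugation[OF Suc.prems(1) cU i] by simp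
    \<comment> \<open>The factor \<open>1\<^sub>m ?n\<close> turns the inner products of columns of \<open>U\<close> into entries of a conjugate of the
      identity, which is the identity.\<close>
    also have "S *\<^sub>v col U 0 = e \<cdot>\<^sub>v (1\<^sub>m ?n *\<^sub>v col U 0)"
      using Suc.prems(1) v ev col0 cU
      by (simp add: mult_mat_vec[OF Suc.prems(1) v(1)] smult_smult_assoc mult.commute one_mult_mat_vec[of _ ?n])
    also have "\<dots> \<bullet>c col U i = e * ((1\<^sub>m ?n *\<^sub>v col U 0) \<bullet>c col U i)"
      using smult_scalar_prod_distrib[OF mult_mat_vec_carrier[OF one_carrier_mat c0] carrier_vec_conjugate[OF ci]] .
    also have "(1\<^sub>m ?n *\<^sub>v col U 0) \<bullet>c col U i = (mat_adjoint U * 1\<^sub>m ?n * U) $$ (i, 0)"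
      using index_conjugation[OF one_carrier_mat cU i] by simp
    also have "mat_adjoint U * 1\<^sub>m ?n * U = 1\<^sub>m ?n"
      using U cU by (simp add: right_mult_one_mat[OF mat_adjoint_carrier] unitary_mat_def)
    finally show ?thesis using i by simp
  qed
  have T0': "T $$ (0, i) = (if i = 0 then e else 0)" if i: "i < ?n" for i
  proof -
    have "T $$ (0, i) = cnj (T $$ (i, 0))"
      using index_mat_adjoint[of 0 T i] cT i hT by simp
    then show ?thesis using T0[OF i] T0[of 0] by (cases "i = 0") auto
  qed
  define R where "R = mat k k (\<lambda>(i, j). T $$ (Suc i, Suc j))"
  have cR: "R \<in> carrier_mat k k" unfolding R_def by simp
  have Tblock: "T = four_block_mat (mat_diag 1 (\<lambda>_. e)) (0\<^sub>m 1 k) (0\<^sub>m k 1) R"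
    using cT T0 T0' unfolding R_def by (intro eq_matI) (auto simp: mat_diag_def)
  have hR: "mat_adjoint R = R"
  proof (rule eq_matI)
    fix i j assume "i < dim_row R" "j < dim_col R"
    then have ij: "i < k" "j < k" using cR by auto
    have "cnj (T $$ (Suc j, Suc i)) = T $$ (Suc i, Suc j)"
      using index_mat_adjoint[of "Suc i" T "Suc j"] cT ij hT by simp
    then show "mat_adjoint R $$ (i, j) = R $$ (i, j)" using ij cR by (simp add: R_def)
  qed (use cR in auto)
  obtain V s where V: "unitary_mat k V" and VR: "mat_adjoint V * R * V = mat_diag k s"
    using Suc.IH[OF cR hR] by blast
  note cV = unitary_mat_carrier[OF V]
  have "mat_adjoint (1\<^sub>m 1) * (1\<^sub>m 1 :: complex mat) = 1\<^sub>m 1"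
    by (rule eq_matI) auto
  then have one: "unitary_mat 1 (1\<^sub>m 1)" by (intro unitary_matI) auto
  define W where "W = direct_sum_mat (1\<^sub>m 1) V"
  have W: "unitary_mat ?n W" using unitary_direct_sum[OF one V] unfolding W_def by simp
  have "mat_adjoint (U * W) * S * (U * W) = mat_adjoint W * T * W"
    unfolding T_def using conjugation_mult[OF cU unitary_mat_carrier[OF W] Suc.prems(1)] .
  also have "\<dots> = four_block_mat (mat_adjoint (1\<^sub>m 1) * mat_diag 1 (\<lambda>_. e) * 1\<^sub>m 1)
      (mat_adjoint (1\<^sub>m 1) * 0\<^sub>m 1 k * V) (mat_adjoint V * 0\<^sub>m k 1 * 1\<^sub>m 1) (mat_diag k s)"
    unfolding W_def Tblock VR[symmetric] using cV cR by (intro conjugation_direct_sum) auto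
  also have "\<dots> = mat_diag ?n (\<lambda>i. if i = 0 then e else s (i - 1))"
    using cV by (intro eq_matI) (auto simp: scalar_prod_def mat_diag_def)
  finally show ?case using unitary_mat_mult[OF U W] by blast
qed

section \<open>Symmetric norms and diagonal parts\<close>

lemma mat_adjoint_diag:
  "mat_adjoint (mat_diag n f) = mat_diag n (\<lambda>i. cnj (f i))"
  by (rule eq_matI) (auto simp: mat_diag_def)

lemma unitary_mat_diag:
  assumes "\<And>i. i < n \<Longrightarrow> cmod (f i) = 1"
  shows "unitary_mat n (mat_diag n f)"
proof (rule unitary_matI)
  have "cnj (f i) * f i = 1" if "i < n" for i
    using assms[OF that] by (simp add: complex_norm_square[symmetric] mult.commute)
  then show "mat_adjoint (mat_diag n f) * mat_diag n f = 1\<^sub>m n"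
    by (intro eq_matI) (auto simp: mat_adjoint_diag, auto simp: mat_diag_def)
qed simp

lemma symmetric_norm_conjugation:
  assumes "symmetric_norm m N" "unitary_mat m U" "T \<in> carrier_mat m m"
  shows "N (mat_adjoint U * T * U) = N T"
  using assms unitary_mat_adjoint by (auto simp: symmetric_norm_def)

lemma matrix_norm_average:
  assumes N: "matrix_norm m N" and c: "S \<in> carrier_mat m m" "T \<in> carrier_mat m m" and eq: "N S = N T"
  shows "N ((1 / 2) \<cdot>\<^sub>m (S + T)) \<le> N T"
proof -
  have "N ((1 / 2) \<cdot>\<^sub>m (S + T)) = N (S + T) / 2"
    using N c unfolding matrix_norm_def by (simp add: norm_divide)
  also have "\<dots> \<le> (N S + N T) / 2"
    using N c unfolding matrix_norm_def by simp
  finally show ?thesis using eq by simp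
qed

text \<open>
  Flipping the sign of the \<open>k\<close>-th basis vector is a unitary conjugation that negates the off-diagonal
  entries of row and column \<open>k\<close> and fixes all others, so averaging with it erases exactly those entries.
  By the triangle inequality the average has no larger norm; doing this for every \<open>k\<close> leaves the diagonal.
\<close>

lemma norm_diagonal_le:
  assumes N: "symmetric_norm m N" and T: "T \<in> carrier_mat m m"
  shows "N (mat_diag m (\<lambda>i. T $$ (i, i))) \<le> N T"
proof -
  \<comment> \<open>\<open>P k\<close> is \<open>T\<close> after the rows and columns with index below \<open>k\<close> have been cleared off the diagonal.\<close>
  define P where "P k = mat m m (\<lambda>(i, j). if i = j \<or> k \<le> i \<and> k \<le> j then T $$ (i, j) else 0)" for k
  have P: "P k \<in> carrier_mat m m" for k by (simp add: P_def)
  have "N (P k) \<le> N T" if "k \<le> m" for k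
    using that
  proof (induction k)
    case 0
    have "P 0 = T" using T by (intro eq_matI) (auto simp: P_def)
    then show ?case by simp
  next
    case (Suc k)
    define f where "f i = (if i = k then - 1 else 1 :: complex)" for i
    define E where "E = mat_diag m f"
    have E: "unitary_mat m E" unfolding E_def by (rule unitary_mat_diag) (simp add: f_def)
    note cE = unitary_mat_carrier[OF E]
    have EPE: "mat_adjoint E * P k * E = mat m m (\<lambda>(i, j). cnj (f i) * P k $$ (i, j) * f j)"
      unfolding E_def mat_adjoint_diag mat_diag_mult_left[OF P]
      by (subst mat_diag_mult_right[of _ m]) (auto intro!: eq_matI)
    have "P (Suc k) = (1 / 2) \<cdot>\<^sub>m (mat_adjoint E * P k * E + P k)"
      unfolding EPE by (intro eq_matI) (auto simp: P_def f_def)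
    also have "N \<dots> \<le> N (P k)"
      using N symmetric_norm_conjugation[OF N E P] P cE
      by (intro matrix_norm_average) (auto simp: symmetric_norm_def intro!: mult_carrier_mat)
    also have "\<dots> \<le> N T" using Suc by simp
    finally show ?case .
  qed
  moreover have "P m = mat_diag m (\<lambda>i. T $$ (i, i))"
    by (intro eq_matI) (auto simp: P_def mat_diag_def)
  ultimately show ?thesis by (metis order_refl)
qed

section \<open>Mixing the two summands with phases\<close>

lemma phase_with_real_part:
  assumes "0 \<le> d" "d \<le> cmod z"
  obtains u where "cmod u = 1" "Re (u * z) = d"
proof (cases "z = 0")
  case True
  then show ?thesis using assms that[of 1] by simp
next
  case False
  \<comment> \<open>\<open>w\<close> has real part \<open>d\<close> and the same modulus as \<open>z\<close>, so it is a rotation of \<open>z\<close>.\<close>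
  define w where "w = Complex d (sqrt ((cmod z)\<^sup>2 - d\<^sup>2))"
  have "d\<^sup>2 \<le> (cmod z)\<^sup>2" using assms by (simp add: power_mono)
  then have "cmod w = cmod z" unfolding w_def by (simp add: complex_norm)
  then show ?thesis using False that[of "w / z"] by (simp add: norm_divide w_def)
qed

text \<open>
  Its columns are the vectors \<open>(e\<^sub>i, u\<^sub>i e\<^sub>i) / sqrt 2\<close>, followed by \<open>(e\<^sub>i, - u\<^sub>i e\<^sub>i) / sqrt 2\<close>.
\<close>

definition phase_mat :: "nat \<Rightarrow> (nat \<Rightarrow> complex) \<Rightarrow> complex mat" where
  "phase_mat n u = (let r = complex_of_real (1 / sqrt 2) in
     four_block_mat (mat_diag n (\<lambda>i. r)) (mat_diag n (\<lambda>i. r))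
       (mat_diag n (\<lambda>i. r * u i)) (mat_diag n (\<lambda>i. - r * u i)))"

text \<open>
  On the diagonal of the first and of the last block, the cross terms appear with sign plus and minus.
  For \<open>Y\<close> the adjoint of \<open>X\<close> and \<open>u\<^sub>i\<close> of modulus one, these diagonal entries are therefore the mean of
  the entries of \<open>A\<close> and \<open>B\<close> at \<open>i\<close>, shifted by plus or minus the real part of \<open>u\<^sub>i\<close> times the entry of \<open>X\<close>.
  The full block formula, applied to the identity in place of the block matrix, also gives the
  unitarity of \<open>phase_mat\<close>.
\<close>

lemma phase_mat_conjugation:
  fixes A X Y B :: "complex mat" and u :: "nat \<Rightarrow> complex"
  assumes A: "A \<in> carrier_mat n n" and X: "X \<in> carrier_mat n n"
    and Y: "Y \<in> carrier_mat n n" and B: "B \<in> carrier_mat n n"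
  defines "P \<equiv> mat_adjoint (phase_mat n u) * four_block_mat A X Y B * phase_mat n u"
  shows "P = four_block_mat
    (mat n n (\<lambda>(i, j). (A $$ (i, j) + X $$ (i, j) * u j + cnj (u i) * Y $$ (i, j) + cnj (u i) * B $$ (i, j) * u j) / 2))
    (mat n n (\<lambda>(i, j). (A $$ (i, j) - X $$ (i, j) * u j + cnj (u i) * Y $$ (i, j) - cnj (u i) * B $$ (i, j) * u j) / 2))
    (mat n n (\<lambda>(i, j). (A $$ (i, j) + X $$ (i, j) * u j - cnj (u i) * Y $$ (i, j) - cnj (u i) * B $$ (i, j) * u j) / 2))
    (mat n n (\<lambda>(i, j). (A $$ (i, j) - X $$ (i, j) * u j - cnj (u i) * Y $$ (i, j) + cnj (u i) * B $$ (i, j) * u j) / 2))"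
proof -
  define r where "r = complex_of_real (1 / sqrt 2)"
  have r: "cnj r = r" "r * r = 1 / 2" "r * (r * z) = z / 2" for z
    unfolding r_def by (simp_all add: flip: of_real_mult mult.assoc)
  let ?D = "mat_diag n"
  let ?R = "?D (\<lambda>i. r)" and ?U = "?D (\<lambda>i. r * u i)" and ?U' = "?D (\<lambda>i. - r * u i)"
    and ?C = "?D (\<lambda>i. r * cnj (u i))" and ?C' = "?D (\<lambda>i. - r * cnj (u i))"
  have K: "phase_mat n u = four_block_mat ?R ?R ?U ?U'"
    by (simp add: phase_mat_def r_def Let_def)
  have K': "mat_adjoint (phase_mat n u) = four_block_mat ?R ?C ?R ?C'"
    unfolding K by (subst mat_adjoint_four_block[of _ n n _ n _ n]) (simp_all add: mat_adjoint_diag r(1))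
  have c: "?D f * Z + ?D g * Z' \<in> carrier_mat n n" if "Z \<in> carrier_mat n n" "Z' \<in> carrier_mat n n" for f g Z Z'
    using that by (intro add_carrier_mat mult_carrier_mat[of _ n n]) auto
  have "P = four_block_mat
      ((?R * A + ?C * Y) * ?R + (?R * X + ?C * B) * ?U) ((?R * A + ?C * Y) * ?R + (?R * X + ?C * B) * ?U')
      ((?R * A + ?C' * Y) * ?R + (?R * X + ?C' * B) * ?U) ((?R * A + ?C' * Y) * ?R + (?R * X + ?C' * B) * ?U')"
    unfolding P_def K' unfolding K
    by (subst mult_four_block_mat[OF mat_diag_dim mat_diag_dim mat_diag_dim mat_diag_dim A X Y B],
        subst mult_four_block_mat[OF c[OF A Y] c[OF X B] c[OF A Y] c[OF X B] mat_diag_dim mat_diag_dim mat_diag_dim mat_diag_dim])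
       (rule refl)
  then show ?thesis using A X Y B
    by (simp add: mat_diag_mult_left[of _ n n] mat_diag_mult_right[of _ n n])
       (intro cong_four_block_mat eq_matI; simp add: r algebra_simps add_divide_distrib diff_divide_distrib)
qed

lemma unitary_phase_mat:
  assumes "\<And>i. i < n \<Longrightarrow> cmod (u i) = 1"
  shows "unitary_mat (n + n) (phase_mat n u)"
proof (rule unitary_matI)
  show K: "phase_mat n u \<in> carrier_mat (n + n) (n + n)"
    by (simp add: phase_mat_def Let_def)
  have u: "cnj (u i) * u i = 1" if "i < n" for i
    using assms[OF that] by (simp add: complex_norm_square[symmetric] mult.commute)
  have "mat_adjoint (phase_mat n u) * phase_mat n u =
      mat_adjoint (phase_mat n u) * four_block_mat (1\<^sub>m n) (0\<^sub>m n n) (0\<^sub>m n n) (1\<^sub>m n) * phase_mat n u"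
    by (simp add: right_mult_one_mat[OF mat_adjoint_carrier[OF K]])
  also have "\<dots> = 1\<^sub>m (n + n)"
    by (subst phase_mat_conjugation[OF one_carrier_mat zero_carrier_mat zero_carrier_mat one_carrier_mat])
       (auto simp: u intro!: eq_matI)
  finally show "mat_adjoint (phase_mat n u) * phase_mat n u = 1\<^sub>m (n + n)" .
qed

section \<open>Numerical range and the norm inequality\<close>

lemma unitary_col_in_numerical_range:
  assumes V: "unitary_mat n V" and X: "X \<in> carrier_mat n n" and i: "i < n"
  shows "(mat_adjoint V * X * V) $$ (i, i) \<in> numerical_range n X"
proof -
  note cV = unitary_mat_carrier[OF V]
  have "complex_of_real ((euclidean_norm (col V i))\<^sup>2) = (\<Sum>k<n. of_real ((cmod (V $$ (k, i)))\<^sup>2))"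
    using cV i by (simp add: euclidean_norm_def L2_set_def sum_nonneg)
  also have "\<dots> = (mat_adjoint V * V) $$ (i, i)"
    using cV i by (simp add: scalar_prod_def complex_norm_square atLeast0LessThan mult.commute del: of_real_power)
  also have "\<dots> = 1" using V i by (simp add: unitary_mat_def)
  finally have "(euclidean_norm (col V i))\<^sup>2 = 1" by (metis of_real_eq_1_iff)
  moreover have "0 \<le> euclidean_norm (col V i)" by (simp add: euclidean_norm_def)
  ultimately have "euclidean_norm (col V i) = 1" by (simp add: power2_eq_1_iff)
  then show ?thesis unfolding numerical_range_def index_conjugation[OF X cV i i]
    using cV i by (auto intro!: exI[of _ "col V i"])
qed

lemma conjugation_add_scalar:
  assumes V: "unitary_mat n V" and S: "S \<in> carrier_mat n n"
  shows "mat_adjoint V * (S + c \<cdot>\<^sub>m 1\<^sub>m n) * V = mat_adjoint V * S * V + c \<cdot>\<^sub>m 1\<^sub>m n"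
proof -
  note cV = unitary_mat_carrier[OF V]
  note cV' = mat_adjoint_carrier[OF cV]
  have "mat_adjoint V * (S + c \<cdot>\<^sub>m 1\<^sub>m n) = mat_adjoint V * S + c \<cdot>\<^sub>m mat_adjoint V"
    using S by (simp add: mult_add_distrib_mat[OF cV' S] mult_smult_distrib[OF cV' one_carrier_mat] right_mult_one_mat[OF cV'])
  also have "\<dots> * V = mat_adjoint V * S * V + c \<cdot>\<^sub>m (mat_adjoint V * V)"
    using cV cV' S by (simp add: add_mult_distrib_mat[of _ n n] mult_smult_assoc_mat[OF cV' cV] mult_carrier_mat[OF cV' S])
  finally show ?thesis using V by (simp add: unitary_mat_def)
qed

theorem theorem2p1:
  fixes n :: nat and A B X :: "complex mat" and d :: real and N :: "complex mat \<Rightarrow> real"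
  assumes "n \<ge> 1"
    and "A \<in> carrier_mat n n" and "B \<in> carrier_mat n n" and "X \<in> carrier_mat n n"
    and "positive_mat (2 * n) (four_block_mat A X (mat_adjoint X) B)"
    and "d = infdist 0 (numerical_range n X)"
    and "symmetric_norm (2 * n) N"
  shows "N (four_block_mat A X (mat_adjoint X) B) \<ge>
         N (direct_sum_mat ((1 / 2) \<cdot>\<^sub>m (A + B) + complex_of_real d \<cdot>\<^sub>m 1\<^sub>m n)
                           ((1 / 2) \<cdot>\<^sub>m (A + B) - complex_of_real d \<cdot>\<^sub>m 1\<^sub>m n))"
proof -
  let ?M = "four_block_mat A X (mat_adjoint X) B"
  note A = assms(2) and B = assms(3) and X = assms(4)
  note X' = mat_adjoint_carrier[OF X]
  have N: "symmetric_norm (n + n) N" using assms(7) by (simp add: mult_2)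
  have M: "?M \<in> carrier_mat (n + n) (n + n)" using A B by simp
  \<comment> \<open>The diagonal blocks of a Hermitian block matrix are Hermitian.\<close>
  have herm: "mat_adjoint A = A" "mat_adjoint B = B"
  proof -
    have "four_block_mat (mat_adjoint A) X (mat_adjoint X) (mat_adjoint B) = ?M"
      using assms(5) mat_adjoint_four_block[OF A X X' B] by (simp add: positive_mat_def)
    then have entry: "four_block_mat (mat_adjoint A) X (mat_adjoint X) (mat_adjoint B) $$ (i, j) = ?M $$ (i, j)" for i j
      by simp
    show "mat_adjoint A = A"
    proof (rule eq_matI)
      fix i j assume "i < dim_row A" "j < dim_col A"
      then show "mat_adjoint A $$ (i, j) = A $$ (i, j)" using entry[of i j] A B by simp
    qed (use A in auto)
    show "mat_adjoint B = B"
    proof (rule eq_matI)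
      fix i j assume "i < dim_row B" "j < dim_col B"
      then show "mat_adjoint B $$ (i, j) = B $$ (i, j)" using entry[of "n + i" "n + j"] A B by simp
    qed (use B in auto)
  qed
  define S where "S = (1 / 2) \<cdot>\<^sub>m (A + B)"
  have S: "S \<in> carrier_mat n n" using A B by (simp add: S_def)
  have "mat_adjoint S = S"
  proof (rule eq_matI)
    fix i j assume "i < dim_row S" "j < dim_col S"
    then have ij: "i < n" "j < n" using S by auto
    have "cnj (A $$ (j, i)) = A $$ (i, j)" "cnj (B $$ (j, i)) = B $$ (i, j)"
      using ij A B herm index_mat_adjoint[of i A j] index_mat_adjoint[of i B j] by auto
    then show "mat_adjoint S $$ (i, j) = S $$ (i, j)" using ij A B by (simp add: S_def)
  qed (use S in auto)
  then obtain V s where V: "unitary_mat n V" and VS: "mat_adjoint V * S * V = mat_diag n s"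
    using hermitian_diagonalization[OF S] by blast
  note cV = unitary_mat_carrier[OF V]
  note cV' = mat_adjoint_carrier[OF cV]
  let ?conj = "\<lambda>Z. mat_adjoint V * Z * V"
  have cc: "?conj Z \<in> carrier_mat n n" if "Z \<in> carrier_mat n n" for Z
    using that cV cV' by (meson mult_carrier_mat)
  have trace_half: "(?conj A $$ (i, i) + ?conj B $$ (i, i)) / 2 = s i" if i: "i < n" for i
  proof -
    have c: "mat_adjoint V * A \<in> carrier_mat n n" "mat_adjoint V * B \<in> carrier_mat n n"
      using mult_carrier_mat[OF cV'] A B by auto
    have "mat_adjoint V * S = (1 / 2) \<cdot>\<^sub>m (mat_adjoint V * A + mat_adjoint V * B)"
      unfolding S_def using A B
      by (simp add: mult_smult_distrib[OF cV', of _ n] mult_add_distrib_mat[OF cV' A B])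
    then have "?conj S = (1 / 2) \<cdot>\<^sub>m (?conj A + ?conj B)"
      using c by (simp add: mult_smult_assoc_mat[of _ n n, OF _ cV] add_mult_distrib_mat[OF c cV])
    then have "mat_diag n s $$ (i, i) = ((1 / 2) \<cdot>\<^sub>m (?conj A + ?conj B)) $$ (i, i)" using VS by simp
    then show ?thesis using i cc[OF A] cc[OF B] cV by (simp add: mat_diag_def)
  qed
  define x where "x i = ?conj X $$ (i, i)" for i
  have "\<exists>u. cmod u = 1 \<and> Re (u * x i) = d" if i: "i < n" for i
  proof -
    have "d \<le> dist 0 (x i)"
      unfolding assms(6) x_def by (rule infdist_le[OF unitary_col_in_numerical_range[OF V X i]])
    then show ?thesis
      using phase_with_real_part[of d "x i"] infdist_nonneg assms(6) by (metis dist_0_norm)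
  qed
  then obtain u where u: "\<And>i. i < n \<Longrightarrow> cmod (u i) = 1" and ux: "\<And>i. i < n \<Longrightarrow> Re (u i * x i) = d"
    by metis
  define W where "W = direct_sum_mat V V"
  have W: "unitary_mat (n + n) W" unfolding W_def by (rule unitary_direct_sum[OF V V])
  have K: "unitary_mat (n + n) (phase_mat n u)" using unitary_phase_mat u .
  define P where "P = mat_adjoint (W * phase_mat n u) * ?M * (W * phase_mat n u)"
  have cP: "P \<in> carrier_mat (n + n) (n + n)"
    unfolding P_def using M unitary_mat_carrier[OF unitary_mat_mult[OF W K]]
    by (meson mult_carrier_mat mat_adjoint_carrier)
  have "P = mat_adjoint (phase_mat n u) *
      four_block_mat (?conj A) (?conj X) (?conj (mat_adjoint X)) (?conj B) * phase_mat n u"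
    unfolding P_def conjugation_mult[OF unitary_mat_carrier[OF W] unitary_mat_carrier[OF K] M]
    by (simp add: conjugation_direct_sum[OF cV cV A X X' B, folded W_def])
  note P_eq = this[unfolded phase_mat_conjugation[OF cc[OF A] cc[OF X] cc[OF X'] cc[OF B]]]
  \<comment> \<open>The two cross terms of the compression to the \<open>i\<close>-th plane are conjugate to each other, and the
    phase was chosen so that their sum is \<open>2 * d\<close>.\<close>
  have off: "x i * u i + cnj (u i) * ?conj (mat_adjoint X) $$ (i, i) = 2 * d" if i: "i < n" for i
  proof -
    have "?conj (mat_adjoint X) = mat_adjoint (?conj X)"
      using mat_adjoint_mult[OF mult_carrier_mat[OF cV' X] cV] mat_adjoint_mult[OF cV' X]
        assoc_mult_mat[OF cV' X' cV] by simp
    then have "?conj (mat_adjoint X) $$ (i, i) = cnj (x i)"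
      using i cc[OF X] cV X by (simp add: x_def)
    then have "x i * u i + cnj (u i) * ?conj (mat_adjoint X) $$ (i, i) = u i * x i + cnj (u i * x i)"
      by simp
    also have "\<dots> = 2 * d" unfolding complex_add_cnj ux[OF i] by simp
    finally show ?thesis .
  qed
  have phase: "cnj (u i) * b * u i = b" if "i < n" for i b
  proof -
    have "cnj (u i) * b * u i = of_real ((cmod (u i))\<^sup>2) * b"
      unfolding complex_norm_square by simp
    then show ?thesis using u[OF that] by simp
  qed
  \<comment> \<open>\<open>t\<close> lists the eigenvalues of the direct sum: it is at once the diagonal of \<open>P\<close> and the diagonal
    form of the direct sum in the basis \<open>W\<close>.\<close>
  define t where "t i = (if i < n then s i + d else s (i - n) - d)" for i
  have diag: "mat_diag (n + n) (\<lambda>i. P $$ (i, i)) = mat_diag (n + n) t"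
  proof (rule eq_matI)
    fix i j assume "i < dim_row (mat_diag (n + n) t)" "j < dim_col (mat_diag (n + n) t)"
    moreover have "P $$ (i, i) = t i" if "i < n + n" for i
    proof (cases "i < n")
      case True
      have "P $$ (i, i) = (?conj A $$ (i, i) + (x i * u i + cnj (u i) * ?conj (mat_adjoint X) $$ (i, i))
          + cnj (u i) * ?conj B $$ (i, i) * u i) / 2"
        using True by (simp add: P_eq x_def)
      also have "\<dots> = t i"
        unfolding off[OF True] phase[OF True] using True
        by (simp add: t_def trace_half[OF True, symmetric] add_divide_distrib)
      finally show ?thesis .
    next
      case False
      define k where "k = i - n"
      have k: "k < n" using False that by (simp add: k_def)
      have "P $$ (i, i) = (?conj A $$ (k, k) - (x k * u k + cnj (u k) * ?conj (mat_adjoint X) $$ (k, k))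
          + cnj (u k) * ?conj B $$ (k, k) * u k) / 2"
        using False that k by (simp add: P_eq x_def k_def)
      also have "\<dots> = t i"
        unfolding off[OF k] phase[OF k] using False
        by (simp add: t_def trace_half[OF k, symmetric] add_divide_distrib diff_divide_distrib flip: k_def)
      finally show ?thesis .
    qed
    ultimately show "mat_diag (n + n) (\<lambda>i. P $$ (i, i)) $$ (i, j) = mat_diag (n + n) t $$ (i, j)"
      by (simp add: mat_diag_def)
  qed (auto simp: mat_diag_def)
  let ?T = "direct_sum_mat (S + complex_of_real d \<cdot>\<^sub>m 1\<^sub>m n) (S - complex_of_real d \<cdot>\<^sub>m 1\<^sub>m n)"
  have T: "?T \<in> carrier_mat (n + n) (n + n)"
    using S by (intro direct_sum_mat_carrier) auto
  have minus: "S - complex_of_real d \<cdot>\<^sub>m 1\<^sub>m n = S + complex_of_real (- d) \<cdot>\<^sub>m 1\<^sub>m n"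
    using S by (intro eq_matI) auto
  have "mat_adjoint W * ?T * W = four_block_mat
      (?conj (S + complex_of_real d \<cdot>\<^sub>m 1\<^sub>m n)) (?conj (0\<^sub>m n n)) (?conj (0\<^sub>m n n))
      (?conj (S - complex_of_real d \<cdot>\<^sub>m 1\<^sub>m n))"
    unfolding W_def using S by (subst (2) direct_sum_mat_eq[of _ n _ n]) (auto intro!: conjugation_direct_sum cV)
  also have "\<dots> = mat_diag (n + n) t"
    unfolding minus conjugation_add_scalar[OF V S] VS using cV cV'
    by (intro eq_matI) (auto simp: mat_diag_def t_def)
  finally have "N ?T = N (mat_diag (n + n) t)"
    using symmetric_norm_conjugation[OF N W T] by simp
  also have "\<dots> \<le> N P" using norm_diagonal_le[OF N cP] diag by simp
  also have "\<dots> = N ?M"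
    unfolding P_def by (rule symmetric_norm_conjugation[OF N unitary_mat_mult[OF W K] M])
  finally show ?thesis unfolding S_def .
qed

end
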